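(* Let $G$ be the graph whose vertices are the square-free integers $\ge 2$, two distinct vertices being joined by an edge if and only if one divides the other, and let $f(x)=x$ on the vertices. For every vertex $x$ of $G$, the graph $S^-_f(x)$ is an (Evako) $m$-sphere for some integer $m\ge -1$. Consequently, $1-\chi(S^-_f(x)) = -\mu(x)$, where $\mu$ is the Möbius function.
   Context: For a vertex $x$ of a simple graph $G$, the unit sphere $S(x)$ is the subgraph of $G$ generated (induced) by all vertices directly connected to $x$. For a real-valued function $f$ on the vertices, $S^-_f(x)$ is the subgraph generated by the vertices $y\in S(x)$ with $f(y)<f(x)$. (For the graph in the claim, $S^-_f(x)$ is generated by the divisors $d$ of $x$ with $1<d<x$.) Contractible graphs (inductive definition): the one-vertex graph is contractible; a finite simple graph $G=(V,E)$ is contractible if there exists a vertex $v$ such that both the unit sphere $S(v)$ and the graph generated by $V\setminus\{v\}$ are contractible. Evako spheres (inductive definition): the empty graph is the $(-1)$-sphere. For $k\ge 0$, a $k$-graph is a finite simple graph for which every unit sphere is a $(k-1)$-sphere. A $k$-sphere is a $k$-graph which becomes contractible after removing some vertex. The Euler characteristic of a finite simple graph $H$ is $\chi(H)=\sum_{k\ge0}(-1)^k v_k(H)$, where $v_k(H)$ is the number of complete subgraphs of $H$ with $k+1$ vertices; the empty graph has $\chi=0$. *)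

theory Defs
  imports
    "HOL-Computational_Algebra.Primes"
    "HOL-Computational_Algebra.Squarefree"
    "Graph_Theory.Kuratowski"
begin

text \<open>
  A simple graph is a symmetric digraph without loops and parallel arcs; the locale predicate
  \<^const>\<open>graph\<close> says this and also that the graph is finite.
\<close>

definition unit_sphere :: "('a, 'b) pre_digraph \<Rightarrow> 'a \<Rightarrow> ('a, 'b) pre_digraph" where
  "unit_sphere G x = G \<restriction> {y \<in> verts G. x \<rightarrow>\<^bsub>G\<^esub> y}"

definition remove_vertex :: "('a, 'b) pre_digraph \<Rightarrow> 'a \<Rightarrow> ('a, 'b) pre_digraph" where
  "remove_vertex G v = G \<restriction> (verts G - {v})"

text \<open>The graph $S^-_f(x)$.\<close>

definition lower_sphere ::
    "('a, 'b) pre_digraph \<Rightarrow> ('a \<Rightarrow> real) \<Rightarrow> 'a \<Rightarrow> ('a, 'b) pre_digraph" where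
  "lower_sphere G f x = G \<restriction> {y \<in> verts (unit_sphere G x). f y < f x}"

inductive contractible_graph :: "('a, 'b) pre_digraph \<Rightarrow> bool" where
  one_vertex: "graph G \<Longrightarrow> card (verts G) = 1 \<Longrightarrow> contractible_graph G"
| extension: "graph G \<Longrightarrow> v \<in> verts G \<Longrightarrow> contractible_graph (unit_sphere G v) \<Longrightarrow>
    contractible_graph (remove_vertex G v) \<Longrightarrow> contractible_graph G"

inductive evako_graph :: "int \<Rightarrow> ('a, 'b) pre_digraph \<Rightarrow> bool"
  and evako_sphere :: "int \<Rightarrow> ('a, 'b) pre_digraph \<Rightarrow> bool" where
  evako_graph: "0 \<le> k \<Longrightarrow> graph G \<Longrightarrow>
    (\<forall>v\<in>verts G. evako_sphere (k - 1) (unit_sphere G v)) \<Longrightarrow> evako_graph k G"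
| sphere_empty: "graph G \<Longrightarrow> verts G = {} \<Longrightarrow> evako_sphere (-1) G"
| sphere: "0 \<le> k \<Longrightarrow> evako_graph k G \<Longrightarrow> v \<in> verts G \<Longrightarrow>
    contractible_graph (remove_vertex G v) \<Longrightarrow> evako_sphere k G"

definition num_cliques :: "('a, 'b) pre_digraph \<Rightarrow> nat \<Rightarrow> nat" where
  "num_cliques H k = card {K. subgraph K H \<and> complete_digraph (k + 1) K}"

text \<open>
  For finite \<open>H\<close>, no complete subgraph has more than \<open>card (verts H)\<close> vertices, so the terms
  with \<open>k \<ge> card (verts H)\<close> of the sum over all \<open>k\<close> vanish.
\<close>

definition euler_char :: "('a, 'b) pre_digraph \<Rightarrow> int" where
  "euler_char H = (\<Sum>k<card (verts H). (-1) ^ k * int (num_cliques H k))"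

definition moebius_mu :: "nat \<Rightarrow> int" where
  "moebius_mu n = (if squarefree n then (-1) ^ card (prime_factors n) else 0)"

definition squarefree_graph :: "(nat, nat \<times> nat) pre_digraph" where
  "squarefree_graph = with_proj
    \<lparr> pverts = {n. 2 \<le> n \<and> squarefree n},
      parcs = {(m, n). 2 \<le> m \<and> squarefree m \<and> 2 \<le> n \<and> squarefree n \<and>
        m \<noteq> n \<and> (m dvd n \<or> n dvd m)} \<rparr>"

end

theory Submission
  imports Defs
begin

text \<open>
  The graph \<open>S\<^sup>-\<^sub>f(x)\<close> is the comparability graph of the proper nontrivial divisors of \<open>x\<close>, that is,
  the barycentric subdivision of the boundary of a simplex whose vertices are the prime factors
  of \<open>x\<close>. With \<open>w\<close> prime factors it is a sphere of dimension \<open>w - 2\<close>.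

  For an induction this is stated for all open intervals \<open>(a, b)\<close> of the divisibility order with
  \<open>b\<close> square-free (\<open>open_interval_sphere\<close>). The unit sphere of a vertex \<open>d\<close> in such an interval is
  the join of the smaller intervals \<open>(a, d)\<close> and \<open>(d, b)\<close>, since an element below \<open>d\<close> divides
  each element above \<open>d\<close>. Joins of spheres are spheres (\<open>evako_sphere_join\<close>), and the dimensions
  match because the prime factors of \<open>b div a\<close> are distributed among \<open>d div a\<close> and \<open>b div d\<close>.
  The remaining condition, that the interval becomes contractible after removing some vertex, is
  met by removing a coatom \<open>b div p\<close>: then \<open>d \<mapsto> lcm d (a * p)\<close> maps what is left into itself and
  retracts it to a cone with apex \<open>a * p\<close> (\<open>contractible_lcm_closed\<close>).

  For the Euler characteristic, sorting the cliques by whether they contain a vertex \<open>v\<close> gives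
  \<open>\<chi>(H) = \<chi>(H - v) + 1 - \<chi>(S(v))\<close>. It follows that contractible graphs have \<open>\<chi> = 1\<close> and that
  a \<open>k\<close>-sphere has \<open>1 - \<chi> = (-1)\<^sup>k\<^sup>+\<^sup>1\<close>; for \<open>k = w - 2\<close> this is \<open>-(-1)\<^sup>w = -\<mu>(x)\<close>.
\<close>


section \<open>Induced subgraphs of a simple graph\<close>

text \<open>
  The graph of square-free integers is infinite, so it is not a \<^const>\<open>graph\<close>; only its finite
  induced subgraphs are.
\<close>
locale simple_graph = loopfree_digraph + nomulti_digraph + sym_digraph
begin

lemma adj_sym: "u \<rightarrow> v \<Longrightarrow> v \<rightarrow> u"
  by (rule graph_symmetric)

lemma adj_irrefl: "\<not> v \<rightarrow> v"
  by (meson adj_not_same)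

lemma dominates_induce_iff: "u \<rightarrow>\<^bsub>G \<restriction> A\<^esub> v \<longleftrightarrow> u \<rightarrow> v \<and> u \<in> A \<and> v \<in> A"
  by (auto simp: arcs_ends_conv image_iff)

lemma induce_induce: "B \<subseteq> A \<Longrightarrow> (G \<restriction> A) \<restriction> B = G \<restriction> B"
  by (auto simp: induce_subgraph_def)

lemma graph_induce_iff: "graph (G \<restriction> A) \<longleftrightarrow> finite A"
proof
  assume "graph (G \<restriction> A)"
  then interpret H: graph "G \<restriction> A" .
  show "finite A" using H.finite_verts by simp
next
  assume fin: "finite A"
  have "arc_to_ends G ` arcs (G \<restriction> A) \<subseteq> A \<times> A"
    by (auto simp: arc_to_ends_def)
  moreover have "inj_on (arc_to_ends G) (arcs (G \<restriction> A))"
    by (rule inj_on_subset[OF inj_on_arc_to_ends]) auto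
  ultimately have fin_arcs: "finite (arcs (G \<restriction> A))"
    using fin by (meson finite_SigmaI finite_imageD finite_subset)
  have "sym (arcs_ends (G \<restriction> A))"
    by (auto simp: sym_def dominates_induce_iff dest: adj_sym)
  then show "graph (G \<restriction> A)"
    using fin fin_arcs
    by unfold_locales (auto simp: symmetric_def dest: no_loops intro: no_multi_arcs)
qed

lemma unit_sphere_induce: "v \<in> A \<Longrightarrow> unit_sphere (G \<restriction> A) v = G \<restriction> {u \<in> A. v \<rightarrow> u}"
  by (auto simp: unit_sphere_def dominates_induce_iff intro!: induce_induce
      arg_cong[where f = "induce_subgraph _"] trans[OF induce_induce])

lemma remove_vertex_induce: "remove_vertex (G \<restriction> A) v = G \<restriction> (A - {v})"
  by (simp add: remove_vertex_def induce_induce)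


section \<open>Cones and joins\<close>

lemma contractible_induceI:
  assumes "finite A" "v \<in> A"
    and S: "contractible_graph (G \<restriction> {u \<in> A. v \<rightarrow> u})"
    and R: "contractible_graph (G \<restriction> (A - {v}))"
  shows "contractible_graph (G \<restriction> A)"
proof (rule extension)
  show "graph (G \<restriction> A)" using assms(1) unfolding graph_induce_iff .
  show "v \<in> verts (G \<restriction> A)" using assms(2) unfolding induce_subgraph_verts .
  show "contractible_graph (unit_sphere (G \<restriction> A) v)"
    unfolding unit_sphere_induce[OF assms(2)] by (rule S)
  show "contractible_graph (remove_vertex (G \<restriction> A) v)"
    unfolding remove_vertex_induce by (rule R)
qed

text \<open>
  Any vertex other than the apex can be deleted, because its unit sphere and its complement are
  smaller cones with the same apex.
\<close>
lemma contractible_cone: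
  assumes "finite A" "a \<in> A" "\<And>u. u \<in> A \<Longrightarrow> u \<noteq> a \<Longrightarrow> a \<rightarrow> u"
  shows "contractible_graph (G \<restriction> A)"
  using assms
proof (induction "card A" arbitrary: A rule: less_induct)
  case less
  show ?case
  proof (cases "A = {a}")
    case True
    then show ?thesis
      by (intro one_vertex) (auto simp: graph_induce_iff)
  next
    case False
    then obtain v where v: "v \<in> A" "v \<noteq> a"
      using less.prems by auto
    let ?S = "{u \<in> A. v \<rightarrow> u}"
    have "?S \<subset> A" using v adj_irrefl by auto
    then have "card ?S < card A"
      using less.prems by (auto intro: psubset_card_mono)
    then have "contractible_graph (G \<restriction> ?S)"
      using less.prems v by (intro less.hyps) (auto dest: adj_sym)
    moreover have "contractible_graph (G \<restriction> (A - {v}))"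
      using less.prems v by (intro less.hyps)
        (auto intro: card_Diff1_less simp del: card_Diff_insert card_Diff_singleton)
    ultimately show ?thesis
      using less.prems(1) v(1) by (intro contractible_induceI[of A v])
  qed
qed

text \<open>
  When all edges between disjoint \<open>A\<close> and \<open>B\<close> are present, the graph on \<open>A \<union> B\<close> is their join, and
  deleting a vertex or taking its unit sphere acts on one factor only. So the vertices of a
  contractible factor can be deleted from the join in the same order as from the factor, until one
  vertex is left, which is the apex of a cone.
\<close>
lemma contractible_join:
  assumes "contractible_graph (G \<restriction> A)" "finite B" "\<And>a b. a \<in> A \<Longrightarrow> b \<in> B \<Longrightarrow> a \<rightarrow> b"
  shows "contractible_graph (G \<restriction> (A \<union> B))"
  using assms
proof (induction "G \<restriction> A" arbitrary: A rule: contractible_graph.induct)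
  case one_vertex
  then obtain a where "A = {a}"
    by (auto simp: card_1_singleton_iff)
  then show ?case
    using one_vertex by (intro contractible_cone[of _ a]) auto
next
  case (extension v)
  from extension.hyps have v: "v \<in> A" "finite A"
    by (auto simp: graph_induce_iff)
  have "v \<notin> B" using v extension.prems(2) adj_irrefl by blast
  have S: "{u \<in> A \<union> B. v \<rightarrow> u} = {u \<in> A. v \<rightarrow> u} \<union> B"
    using v extension.prems(2) by auto
  have R: "A \<union> B - {v} = (A - {v}) \<union> B"
    using \<open>v \<notin> B\<close> by auto
  show ?case
  proof (rule contractible_induceI[of _ v])
    show "finite (A \<union> B)" "v \<in> A \<union> B"
      using v extension.prems(1) by auto
    show "contractible_graph (G \<restriction> {u \<in> A \<union> B. v \<rightarrow> u})"
      unfolding S using v extension.prems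
      by (intro extension.hyps(4)) (auto simp: unit_sphere_induce)
    show "contractible_graph (G \<restriction> (A \<union> B - {v}))"
      unfolding R using v extension.prems
      by (intro extension.hyps(6)) (auto simp: remove_vertex_induce)
  qed
qed

lemma evako_sphere_finite: "evako_sphere k (G \<restriction> A) \<Longrightarrow> finite A"
  by (auto elim!: evako_sphere.cases evako_graph.cases simp: graph_induce_iff)

lemma evako_sphere_induceI:
  assumes "0 \<le> k" "finite A" "v \<in> A" "contractible_graph (G \<restriction> (A - {v}))"
    and "\<And>u. u \<in> A \<Longrightarrow> evako_sphere (k - 1) (G \<restriction> {w \<in> A. u \<rightarrow> w})"
  shows "evako_sphere k (G \<restriction> A)"
  using assms
  by (intro sphere[of k _ v] evako_graph)
    (auto simp: graph_induce_iff unit_sphere_induce remove_vertex_induce)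

lemma evako_sphere_induceE:
  assumes "evako_sphere k (G \<restriction> A)"
  obtains "k = -1" "A = {}"
  | v where "0 \<le> k" "v \<in> A" "contractible_graph (G \<restriction> (A - {v}))"
      "\<And>u. u \<in> A \<Longrightarrow> evako_sphere (k - 1) (G \<restriction> {w \<in> A. u \<rightarrow> w})"
  using assms
  by (auto elim!: evako_sphere.cases evako_graph.cases
      simp: unit_sphere_induce remove_vertex_induce)

text \<open>
  Unit spheres in a join are joins of a smaller sphere with the other factor, so the induction is on
  the number of vertices. The \<open>-1\<close>-sphere is the neutral element of the join, which explains the
  shift by \<open>1\<close> in the dimension.
\<close>
lemma evako_sphere_join:
  assumes "evako_sphere k (G \<restriction> A)" "evako_sphere l (G \<restriction> B)"
    and "\<And>a b. a \<in> A \<Longrightarrow> b \<in> B \<Longrightarrow> a \<rightarrow> b"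
  shows "evako_sphere (k + l + 1) (G \<restriction> (A \<union> B))"
  using assms
proof (induction "card (A \<union> B)" arbitrary: k l A B rule: less_induct)
  case less
  have fin: "finite A" "finite B"
    using less.prems by (auto dest: evako_sphere_finite)
  have disj: "A \<inter> B = {}"
    using less.prems(3) adj_irrefl by blast
  show ?case
    using less.prems(1)
  proof (cases rule: evako_sphere_induceE)
    case 1
    then show ?thesis using less.prems by simp
  next
    case (2 v)
    note A = 2
    show ?thesis
      using less.prems(2)
    proof (cases rule: evako_sphere_induceE)
      case 1
      then show ?thesis using less.prems by simp
    next
      case (2 w)
      note B = 2
      have smaller: "card C < card (A \<union> B)" if "C \<subseteq> A \<union> B - {u}" "u \<in> A \<union> B" for C u
        using that fin by (intro psubset_card_mono) auto
      show ?thesis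
      proof (rule evako_sphere_induceI[of _ _ v])
        have "contractible_graph (G \<restriction> ((A - {v}) \<union> B))"
          using A less.prems fin by (intro contractible_join) auto
        moreover have "A \<union> B - {v} = (A - {v}) \<union> B"
          using A disj by auto
        ultimately show "contractible_graph (G \<restriction> (A \<union> B - {v}))" by simp
      next
        fix u assume u: "u \<in> A \<union> B"
        show "evako_sphere (k + l + 1 - 1) (G \<restriction> {w \<in> A \<union> B. u \<rightarrow> w})"
        proof (cases "u \<in> A")
          case True
          then have eq: "{w \<in> A \<union> B. u \<rightarrow> w} = {w \<in> A. u \<rightarrow> w} \<union> B"
            using less.prems(3) by auto
          have "card ({w \<in> A. u \<rightarrow> w} \<union> B) < card (A \<union> B)"
            using True disj adj_irrefl by (intro smaller[of _ u]) auto
          then have "evako_sphere ((k - 1) + l + 1) (G \<restriction> ({w \<in> A. u \<rightarrow> w} \<union> B))"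
            using A(4)[OF True] less.prems by (intro less.hyps) auto
          then show ?thesis unfolding eq by simp
        next
          case False
          then have "u \<in> B" using u by simp
          then have eq: "{w \<in> A \<union> B. u \<rightarrow> w} = A \<union> {w \<in> B. u \<rightarrow> w}"
            using less.prems(3) adj_sym by auto
          have "card (A \<union> {w \<in> B. u \<rightarrow> w}) < card (A \<union> B)"
            using \<open>u \<in> B\<close> disj adj_irrefl by (intro smaller[of _ u]) auto
          then have "evako_sphere (k + (l - 1) + 1) (G \<restriction> (A \<union> {w \<in> B. u \<rightarrow> w}))"
            using B(4)[OF \<open>u \<in> B\<close>] less.prems by (intro less.hyps) auto
          then show ?thesis unfolding eq by (simp add: algebra_simps)
        qed
      qed (use A B fin in auto)
    qed
  qed
qed

end


section \<open>The Euler characteristic of spheres\<close>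

definition cliques :: "('a, 'b) pre_digraph \<Rightarrow> 'a set set" where
  "cliques H = {S. S \<subseteq> verts H \<and> (\<forall>u\<in>S. \<forall>v\<in>S. u \<noteq> v \<longrightarrow> u \<rightarrow>\<^bsub>H\<^esub> v)}"

context graph
begin

sublocale simple_graph
  by unfold_locales

lemma finite_cliques: "finite (cliques G)"
  by (rule finite_subset[of _ "Pow (verts G)"]) (auto simp: cliques_def)

lemma graph_unit_sphere: "graph (unit_sphere G v)"
  by (simp add: unit_sphere_def graph_induce_iff)

lemma graph_remove_vertex: "graph (remove_vertex G v)"
  by (simp add: remove_vertex_def graph_induce_iff)

text \<open>A complete subgraph has all arcs between its vertices, so it is induced.\<close>
lemma num_cliques_eq: "num_cliques G k = card {S \<in> cliques G. card S = k + 1}"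
proof -
  have "bij_betw (\<lambda>S. G \<restriction> S) {S \<in> cliques G. card S = k + 1}
      {K. subgraph K G \<and> complete_digraph (k + 1) K}"
  proof (rule bij_betwI[where g = verts])
    show "(\<lambda>S. G \<restriction> S) \<in> {S \<in> cliques G. card S = k + 1} \<rightarrow>
        {K. subgraph K G \<and> complete_digraph (k + 1) K}"
    proof
      fix S assume "S \<in> {S \<in> cliques G. card S = k + 1}"
      then have S: "S \<subseteq> verts G" "\<And>u v. u \<in> S \<Longrightarrow> v \<in> S \<Longrightarrow> u \<noteq> v \<Longrightarrow> u \<rightarrow> v" "card S = k + 1"
        by (auto simp: cliques_def)
      have "arcs_ends (G \<restriction> S) = {(u, v). (u, v) \<in> S \<times> S \<and> u \<noteq> v}"
        using S adj_irrefl by (auto simp: dominates_induce_iff)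
      then show "G \<restriction> S \<in> {K. subgraph K G \<and> complete_digraph (k + 1) K}"
        using S finite_subset[OF S(1)] induced_imp_subgraph[OF induced_induce[OF S(1)]]
        by (simp add: complete_digraph_def graph_induce_iff)
    qed
    show "verts \<in> {K. subgraph K G \<and> complete_digraph (k + 1) K} \<rightarrow>
        {S \<in> cliques G. card S = k + 1}"
      by (auto simp: cliques_def complete_digraph_def dest: subgraph_imp_subverts
          arcs_ends_mono[THEN subsetD])
  next
    fix K assume "K \<in> {K. subgraph K G \<and> complete_digraph (k + 1) K}"
    then have K: "subgraph K G" "graph K"
      and ends: "arcs_ends K = {(u, v). (u, v) \<in> verts K \<times> verts K \<and> u \<noteq> v}"
      by (auto simp: complete_digraph_def)
    interpret K: graph K by fact
    have compat: "tail K = tail G" "head K = head G"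
      using K(1) by (auto simp: subgraph_def compatible_def)
    have "arcs K = {e \<in> arcs G. tail G e \<in> verts K \<and> head G e \<in> verts K}"
    proof (intro equalityI subsetI)
      fix e assume "e \<in> arcs K"
      then show "e \<in> {e \<in> arcs G. tail G e \<in> verts K \<and> head G e \<in> verts K}"
        using K(1) K.tail_in_verts[of e] K.head_in_verts[of e] by (auto simp: compat)
    next
      fix e assume "e \<in> {e \<in> arcs G. tail G e \<in> verts K \<and> head G e \<in> verts K}"
      then have e: "e \<in> arcs G" "(tail G e, head G e) \<in> arcs_ends K"
        using ends no_loops by auto
      then obtain e' where e': "e' \<in> arcs K" "tail G e' = tail G e" "head G e' = head G e"
        by (auto simp: arcs_ends_conv compat)
      then have "e' = e"
        using K(1) e by (intro no_multi_arcs) (auto simp: arc_to_ends_def)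
      then show "e \<in> arcs K" using e' by simp
    qed
    then show "G \<restriction> verts K = K"
      by (intro pre_digraph.equality) (auto simp: compat)
  qed simp
  then show ?thesis
    by (simp add: num_cliques_def bij_betw_same_card)
qed

text \<open>The term \<open>1\<close> accounts for the empty clique.\<close>
lemma euler_char_cliques: "1 - euler_char G = (\<Sum>S\<in>cliques G. (-1) ^ card S)"
proof -
  have fin: "finite S" "card S \<le> card (verts G)" if "S \<in> cliques G" for S
    using that finite_subset[of S "verts G"] by (auto simp: cliques_def intro: card_mono)
  have "(\<Sum>S\<in>cliques G. (-1) ^ card S :: int) =
      (\<Sum>j\<le>card (verts G). \<Sum>S\<in>{S \<in> cliques G. card S = j}. (-1) ^ card S)"
    using finite_cliques fin by (intro sum.group[symmetric]) auto
  also have "\<dots> = (\<Sum>j\<le>card (verts G). (-1) ^ j * int (card {S \<in> cliques G. card S = j}))"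
    by (intro sum.cong refl) (simp add: mult.commute)
  also have "\<dots> = int (card {S \<in> cliques G. card S = 0}) +
      (\<Sum>k<card (verts G). (-1) ^ Suc k * int (card {S \<in> cliques G. card S = Suc k}))"
    by (subst sum.atMost_shift) simp
  also have "{S \<in> cliques G. card S = 0} = {{}}"
  proof -
    have "{} \<in> cliques G" by (simp add: cliques_def)
    then show ?thesis using fin(1) by (auto simp: card_eq_0_iff)
  qed
  finally show ?thesis
    by (simp add: euler_char_def num_cliques_eq sum_negf)
qed

text \<open>
  The cliques that contain \<open>v\<close> arise from those of the unit sphere of \<open>v\<close> by inserting \<open>v\<close>, which
  changes the sign.
\<close>
lemma euler_char_remove_vertex:
  assumes v: "v \<in> verts G"
  shows "euler_char G = euler_char (remove_vertex G v) + (1 - euler_char (unit_sphere G v))"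
proof -
  interpret R: graph "remove_vertex G v" by (rule graph_remove_vertex)
  interpret S: graph "unit_sphere G v" by (rule graph_unit_sphere)
  have split: "cliques G = cliques (remove_vertex G v) \<union> insert v ` cliques (unit_sphere G v)"
  proof (intro equalityI subsetI)
    fix C assume C: "C \<in> cliques G"
    show "C \<in> cliques (remove_vertex G v) \<union> insert v ` cliques (unit_sphere G v)"
    proof (cases "v \<in> C")
      case True
      have "C - {v} \<in> cliques (unit_sphere G v)"
        using C True by (auto simp: cliques_def unit_sphere_def dominates_induce_iff)
      moreover have "C = insert v (C - {v})" using True by auto
      ultimately show ?thesis by blast
    next
      case False
      then show ?thesis
        using C by (auto simp: cliques_def remove_vertex_def dominates_induce_iff)
    qed
  next
    fix C assume "C \<in> cliques (remove_vertex G v) \<union> insert v ` cliques (unit_sphere G v)"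
    then show "C \<in> cliques G"
      using v
      by (auto simp: cliques_def remove_vertex_def unit_sphere_def dominates_induce_iff
          dest: adj_sym)
  qed
  have new: "v \<notin> C" "finite C" if "C \<in> cliques (unit_sphere G v)" for C
    using that adj_irrefl finite_subset[of C "verts G"]
    by (auto simp: cliques_def unit_sphere_def)
  have "(\<Sum>C\<in>cliques G. (-1) ^ card C :: int) =
      (\<Sum>C\<in>cliques (remove_vertex G v). (-1) ^ card C) +
      (\<Sum>C\<in>insert v ` cliques (unit_sphere G v). (-1) ^ card C)"
    unfolding split
    by (intro sum.union_disjoint finite_imageI R.finite_cliques S.finite_cliques)
      (auto simp: cliques_def remove_vertex_def)
  also have "(\<Sum>C\<in>insert v ` cliques (unit_sphere G v). (-1) ^ card C :: int) =
      (\<Sum>C\<in>cliques (unit_sphere G v). (-1) ^ card (insert v C))"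
    using new by (intro sum.reindex_cong[of "insert v"]) (auto simp: inj_on_def insert_ident)
  also have "\<dots> = - (\<Sum>C\<in>cliques (unit_sphere G v). (-1) ^ card C)"
    using new by (simp add: sum_negf)
  finally show ?thesis
    using euler_char_cliques R.euler_char_cliques S.euler_char_cliques by simp
qed

end

lemma euler_char_empty: "verts H = {} \<Longrightarrow> euler_char H = 0"
  by (simp add: euler_char_def)

lemma euler_char_contractible:
  assumes "contractible_graph H"
  shows "euler_char H = 1"
  using assms
proof induction
  case (one_vertex H)
  then interpret graph H by simp
  obtain v where v: "verts H = {v}"
    using one_vertex by (auto simp: card_1_singleton_iff)
  have "verts (remove_vertex H v) = {}" "verts (unit_sphere H v) = {}"
    using v adj_irrefl by (auto simp: remove_vertex_def unit_sphere_def)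
  then show ?case
    using euler_char_remove_vertex[of v] v by (simp add: euler_char_empty)
next
  case (extension H v)
  then interpret graph H by simp
  show ?case
    using euler_char_remove_vertex[of v] extension by simp
qed

text \<open>
  Deleting the vertex that makes a sphere contractible leaves Euler characteristic \<open>1\<close>, so only the
  unit sphere of that vertex, of one dimension less, contributes to \<open>1 - \<chi>\<close>.
\<close>
lemma euler_char_sphere:
  assumes "evako_sphere k H"
  shows "1 - euler_char H = (-1) ^ nat (k + 1)"
  using assms
proof (induction "nat (k + 1)" arbitrary: k H)
  case 0
  from 0(2) show ?case
  proof cases
    case sphere_empty
    then show ?thesis by (simp add: euler_char_empty)
  next
    case (sphere v)
    then show ?thesis using 0(1) by linarith
  qed
next
  case (Suc n)
  from Suc.prems show ?case
  proof cases
    case sphere_empty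
    then show ?thesis using Suc.hyps(2) by linarith
  next
    case (sphere v)
    from sphere(2) have "graph H" and unit: "evako_sphere (k - 1) (unit_sphere H v)"
      using sphere(3) by (auto elim: evako_graph.cases)
    interpret graph H by fact
    have n: "n = nat (k - 1 + 1)" and n': "nat (k + 1) = Suc n"
      using Suc.hyps(2) by linarith+
    have "1 - euler_char (unit_sphere H v) = (-1) ^ n"
      using Suc.hyps(1)[OF n unit] n by simp
    moreover have "euler_char (remove_vertex H v) = 1"
      using sphere(4) by (rule euler_char_contractible)
    ultimately show ?thesis
      using euler_char_remove_vertex[OF sphere(3)] unfolding n' by simp
  qed
qed


section \<open>Open intervals of square-free divisors\<close>

interpretation SF: simple_graph squarefree_graph
  by unfold_locales (auto simp: squarefree_graph_def with_proj_def arc_to_ends_def symmetric_def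
      arcs_ends_conv sym_def image_iff)

lemma verts_squarefree_graph [simp]: "verts squarefree_graph = {n. 2 \<le> n \<and> squarefree n}"
  by (simp add: squarefree_graph_def with_proj_def)

lemma dominates_squarefree_graph:
  "m \<rightarrow>\<^bsub>squarefree_graph\<^esub> n \<longleftrightarrow> 2 \<le> m \<and> squarefree m \<and> 2 \<le> n \<and> squarefree n \<and>
    m \<noteq> n \<and> (m dvd n \<or> n dvd m)"
  by (auto simp: squarefree_graph_def with_proj_def arcs_ends_conv image_iff)

text \<open>
  The map \<open>d \<mapsto> lcm d q\<close> pushes every element up into the cone with apex \<open>q\<close>. An element \<open>d\<close> that is
  not yet in the cone, and is maximal with this property, can be deleted: everything comparable
  with \<open>d\<close> is comparable with \<open>lcm d q\<close>.
\<close>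
lemma contractible_lcm_closed:
  assumes "finite A" "A \<subseteq> verts squarefree_graph" "q \<in> A" "\<And>d. d \<in> A \<Longrightarrow> lcm d q \<in> A"
  shows "contractible_graph (squarefree_graph \<restriction> A)"
  using assms
proof (induction "card A" arbitrary: A rule: less_induct)
  case less
  define U where "U = {d \<in> A. \<not> q dvd d}"
  show ?case
  proof (cases "U = {}")
    case True
    then show ?thesis
      using less.prems
      by (intro SF.contractible_cone[of _ q]) (auto simp: U_def dominates_squarefree_graph)
  next
    case False
    have "finite U" using less.prems by (simp add: U_def)
    define d where "d = Max U"
    have "d \<in> U" and max: "\<And>e. e \<in> U \<Longrightarrow> e \<le> d"
      using False \<open>finite U\<close> by (auto simp: d_def)
    then have d: "d \<in> A" "\<not> q dvd d" by (auto simp: U_def)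
    define L where "L = lcm d q"
    have L: "L \<in> A" "d dvd L" "q dvd L"
      using less.prems d by (auto simp: L_def)
    have "L \<noteq> d" using L d by auto
    let ?S = "{u \<in> A. d \<rightarrow>\<^bsub>squarefree_graph\<^esub> u}"
    have "contractible_graph (squarefree_graph \<restriction> ?S)"
    proof (rule SF.contractible_cone[of _ L])
      show "finite ?S" using less.prems by simp
      show "L \<in> ?S" using L less.prems(2) d \<open>L \<noteq> d\<close> by (auto simp: dominates_squarefree_graph)
    next
      fix u assume u: "u \<in> ?S" "u \<noteq> L"
      have "u dvd L \<or> L dvd u"
      proof (cases "u dvd d")
        case True
        then show ?thesis using L dvd_trans by blast
      next
        case False
        then have "d dvd u" "d \<noteq> u" "2 \<le> u"
          using u by (auto simp: dominates_squarefree_graph)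
        then have "d < u" using dvd_imp_le[of d u] by simp
        then have "q dvd u" using max[of u] u by (auto simp: U_def)
        then show ?thesis using \<open>d dvd u\<close> by (simp add: L_def)
      qed
      then show "L \<rightarrow>\<^bsub>squarefree_graph\<^esub> u"
        using u L less.prems(2) by (auto simp: dominates_squarefree_graph)
    qed
    moreover have "contractible_graph (squarefree_graph \<restriction> (A - {d}))"
    proof (rule less.hyps)
      show "card (A - {d}) < card A"
        using less.prems(1) d(1) by (rule card_Diff1_less)
      show "finite (A - {d})" "A - {d} \<subseteq> verts squarefree_graph" "q \<in> A - {d}"
        using less.prems(1-3) d by auto
    next
      fix e assume "e \<in> A - {d}"
      moreover have "lcm e q \<noteq> d" using d(2) by (metis dvd_lcm2)
      ultimately show "lcm e q \<in> A - {d}" using less.prems(4) by simp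
    qed
    ultimately show ?thesis
      using less.prems(1) d(1) by (intro SF.contractible_induceI[of A d])
  qed
qed

definition open_interval :: "nat \<Rightarrow> nat \<Rightarrow> nat set" where
  "open_interval a b = {d. a dvd d \<and> d dvd b \<and> d \<noteq> a \<and> d \<noteq> b}"

lemma squarefree_nonzero: "squarefree (b :: nat) \<Longrightarrow> b \<noteq> 0"
  by (metis not_squarefree_0)

lemma finite_open_interval: "squarefree b \<Longrightarrow> finite (open_interval a b)"
  by (rule finite_subset[of _ "{d. d dvd b}"])
    (auto simp: open_interval_def dest: squarefree_nonzero)

lemma open_interval_verts:
  assumes "squarefree b"
  shows "open_interval a b \<subseteq> verts squarefree_graph"
proof
  fix d assume d: "d \<in> open_interval a b"
  then have "squarefree d" using assms squarefree_mono by (auto simp: open_interval_def)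
  moreover from this have "d \<noteq> 0" by (rule squarefree_nonzero)
  moreover have "d \<noteq> 1" using d by (auto simp: open_interval_def)
  ultimately show "d \<in> verts squarefree_graph" by simp
qed

lemma sphere_open_interval:
  assumes "squarefree b" "d \<in> open_interval a b"
  shows "{u \<in> open_interval a b. d \<rightarrow>\<^bsub>squarefree_graph\<^esub> u} = open_interval a d \<union> open_interval d b"
  using assms open_interval_verts[OF assms(1), of a]
  by (auto simp: open_interval_def dominates_squarefree_graph intro: dvd_trans dvd_antisym)

lemma card_prime_factors_mult_squarefree:
  assumes "squarefree (m * n :: nat)"
  shows "card (prime_factors (m * n)) = card (prime_factors m) + card (prime_factors n)"
proof -
  have nz: "m \<noteq> 0" "n \<noteq> 0" using squarefree_nonzero[OF assms] by auto
  have "\<not> (p dvd m \<and> p dvd n)" if "prime p" for p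
    using squarefreeD[OF assms, of p] that by (auto simp: power2_eq_square mult_dvd_mono)
  then have "prime_factors m \<inter> prime_factors n = {}"
    by (auto simp: in_prime_factors_iff)
  then show ?thesis
    using nz by (simp add: prime_factors_product card_Un_disjoint)
qed

text \<open>
  The induction is on \<open>b - a\<close>, since passing from \<open>(a, b)\<close> to \<open>(a, d)\<close> or \<open>(d, b)\<close> shortens the
  interval. It is \<open>b\<close> that is assumed to be square-free, rather than only \<open>b div a\<close>, because the
  elements of the interval have to be vertices of the graph.
\<close>
lemma open_interval_sphere:
  assumes "squarefree b" "a dvd b" "a \<noteq> b"
  shows "evako_sphere (int (card (prime_factors (b div a))) - 2)
    (squarefree_graph \<restriction> open_interval a b)"
  using assms
proof (induction "b - a" arbitrary: a b rule: less_induct)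
  case less
  let ?G = squarefree_graph
  obtain m where m: "b = a * m" using less.prems by blast
  have pos: "a > 0" "b > 0" "m > 0"
    using squarefree_nonzero[OF less.prems(1)] m by auto
  have "m \<noteq> 1" using m less.prems by auto
  then obtain p where p: "prime p" "p dvd m" using prime_factor_nat by blast
  then obtain n where n: "m = p * n" by blast
  have b: "b = a * p * n" using m n by simp
  have npos: "n > 0" "p > 1" using pos n p prime_gt_1_nat by auto
  show ?case
  proof (cases "n = 1")
    case True
    have "open_interval a b = {}"
    proof (intro equals0I)
      fix d assume "d \<in> open_interval a b"
      then obtain t where "d = a * t" "a * t dvd a * p" "t \<noteq> 1" "t \<noteq> p"
        using b True by (auto simp: open_interval_def)
      then show False using p(1) pos by (auto simp: prime_nat_iff)
    qed
    moreover have "prime_factors (b div a) = {p}"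
      using b True pos p by (simp add: prime_prime_factors)
    ultimately show ?thesis
      by (simp add: sphere_empty SF.graph_induce_iff)
  next
    case False
    define q where "q = a * p"
    define c where "c = a * n"
    have q: "q \<in> open_interval a b" and c: "c \<in> open_interval a b" and qc: "\<not> q dvd c"
    proof -
      show "q \<in> open_interval a b"
        using False b pos npos by (auto simp: open_interval_def q_def)
      show "c \<in> open_interval a b"
        using False b pos npos by (auto simp: open_interval_def c_def)
      show "\<not> q dvd c"
      proof
        assume "q dvd c"
        then have "p dvd n" using pos by (simp add: q_def c_def)
        then have "p ^ 2 dvd b"
          unfolding b power2_eq_square by (metis dvd_triv_right mult_dvd_mono)
        then show False using less.prems(1) p(1) by (auto simp: squarefree_def)
      qed
    qed
    \<comment> \<open>The coatom \<open>c\<close> is the only interior element whose \<open>lcm\<close> with \<open>q\<close> leaves the interval.\<close>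
    have contr: "contractible_graph (?G \<restriction> (open_interval a b - {c}))"
    proof (rule contractible_lcm_closed[of _ q])
      show "finite (open_interval a b - {c})"
        using finite_open_interval less.prems by simp
      show "open_interval a b - {c} \<subseteq> verts ?G"
        using open_interval_verts less.prems by blast
      show "q \<in> open_interval a b - {c}" using q qc by auto
    next
      fix d assume d: "d \<in> open_interval a b - {c}"
      then have d': "a dvd d" "d dvd b" "d \<noteq> a" "d \<noteq> b" "d \<noteq> c"
        by (auto simp: open_interval_def)
      have qd: "q dvd b" "q > a"
        using q pos npos by (auto simp: open_interval_def q_def)
      have "lcm d q \<noteq> b"
      proof
        assume L: "lcm d q = b"
        have "q dvd d * p" using d' by (auto simp: q_def intro: mult_dvd_mono)
        then have "lcm d q dvd d * p" by simp
        moreover obtain t where t: "lcm d q = d * t" by (meson dvd_lcm1 dvdE)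
        moreover have "d > 0" using d' pos by (auto intro: Nat.gr0I)
        ultimately have "t dvd p" by simp
        then have "t = 1 \<or> t = p" using p(1) by (auto simp: prime_nat_iff)
        then show False using t L d' b npos by (auto simp: c_def)
      qed
      moreover have "lcm d q \<noteq> a"
        using qd dvd_imp_le[of q a] pos by (metis dvd_lcm2 not_less)
      moreover have "lcm d q \<noteq> c" using qc by (metis dvd_lcm2)
      ultimately show "lcm d q \<in> open_interval a b - {c}"
        using d' qd by (auto simp: open_interval_def intro: dvd_trans[OF _ dvd_lcm1])
    qed
    \<comment> \<open>The dimensions of the two factors of a unit sphere add up as required for the join.\<close>
    have dim: "card (prime_factors (b div a)) =
        card (prime_factors (d div a)) + card (prime_factors (b div d))"
      if "d \<in> open_interval a b" for d
    proof -
      have "a dvd d" "d dvd b" using that by (auto simp: open_interval_def)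
      then obtain s t where st: "d = a * s" "b = d * t" by (meson dvdE)
      have "squarefree (s * t)"
        using less.prems(1) squarefree_mono[of "s * t" b] st by (simp add: mult.assoc)
      then show ?thesis
        using pos st by (simp add: card_prime_factors_mult_squarefree mult.assoc)
    qed
    have nonempty: "card (prime_factors (v div u)) > 0"
      if "u dvd v" "u \<noteq> v" "v > 0" for u v :: nat
    proof -
      from that(1) obtain r where "v = u * r" by (elim dvdE)
      moreover from this have "r \<noteq> 1" "u > 0" "r > 0" using that by auto
      ultimately show ?thesis by (auto simp: card_gt_0_iff prime_factorization_empty_iff)
    qed
    show ?thesis
    proof (rule SF.evako_sphere_induceI[OF _ _ c contr])
      have "card (prime_factors (q div a)) > 0" "card (prime_factors (b div q)) > 0"
        using q pos by (intro nonempty; auto simp: open_interval_def q_def)+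
      then show "0 \<le> int (card (prime_factors (b div a))) - 2"
        using dim[OF q] by simp
      show "finite (open_interval a b)" using finite_open_interval less.prems by simp
    next
      fix d assume d: "d \<in> open_interval a b"
      then have d': "a dvd d" "d dvd b" "d \<noteq> a" "d \<noteq> b" by (auto simp: open_interval_def)
      have "a < d" "d < b"
        using d' pos dvd_imp_le[of a d] dvd_imp_le[of d b] by (auto intro!: le_neq_trans Nat.gr0I)
      have sqd: "squarefree d" using d' less.prems squarefree_mono by blast
      have "evako_sphere (int (card (prime_factors (d div a))) - 2 +
          (int (card (prime_factors (b div d))) - 2) + 1)
          (?G \<restriction> (open_interval a d \<union> open_interval d b))"
      proof (rule SF.evako_sphere_join)
        show "evako_sphere (int (card (prime_factors (d div a))) - 2) (?G \<restriction> open_interval a d)"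
          using \<open>a < d\<close> \<open>d < b\<close> d' sqd by (intro less.hyps) auto
        show "evako_sphere (int (card (prime_factors (b div d))) - 2) (?G \<restriction> open_interval d b)"
          using \<open>a < d\<close> \<open>d < b\<close> d' less.prems by (intro less.hyps) auto
      next
        fix u w assume uw: "u \<in> open_interval a d" "w \<in> open_interval d b"
        then have "u dvd w" "u \<noteq> w"
          by (auto simp: open_interval_def intro: dvd_trans dest: dvd_antisym)
        then show "u \<rightarrow>\<^bsub>?G\<^esub> w"
          using uw open_interval_verts[OF sqd, of a] open_interval_verts[OF less.prems(1), of d]
          by (auto simp: dominates_squarefree_graph)
      qed
      then show "evako_sphere (int (card (prime_factors (b div a))) - 2 - 1)
          (?G \<restriction> {w \<in> open_interval a b. d \<rightarrow>\<^bsub>?G\<^esub> w})"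
        using dim[OF d] sphere_open_interval[OF less.prems(1) d] by (simp add: algebra_simps)
    qed
  qed
qed

lemma lower_sphere_squarefree_graph:
  assumes "x \<in> verts squarefree_graph"
  shows "lower_sphere squarefree_graph real x = squarefree_graph \<restriction> open_interval 1 x"
proof -
  have "{y. 2 \<le> y \<and> squarefree y \<and> x \<rightarrow>\<^bsub>squarefree_graph\<^esub> y \<and> y < x} = open_interval 1 x"
  proof (intro equalityI subsetI)
    fix y assume y: "y \<in> {y. 2 \<le> y \<and> squarefree y \<and> x \<rightarrow>\<^bsub>squarefree_graph\<^esub> y \<and> y < x}"
    then have "\<not> x dvd y" using dvd_imp_le[of x y] by auto
    then show "y \<in> open_interval 1 x"
      using y by (auto simp: open_interval_def dominates_squarefree_graph)
  next
    fix y assume y: "y \<in> open_interval 1 x"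
    then have "y \<in> verts squarefree_graph" using assms open_interval_verts by auto
    moreover have "y \<le> x" "y \<noteq> x" using y assms by (auto simp: open_interval_def dvd_imp_le)
    ultimately show "y \<in> {y. 2 \<le> y \<and> squarefree y \<and> x \<rightarrow>\<^bsub>squarefree_graph\<^esub> y \<and> y < x}"
      using y assms by (auto simp: open_interval_def dominates_squarefree_graph)
  qed
  then show ?thesis
    by (simp add: lower_sphere_def unit_sphere_def conj_assoc)
qed

theorem proposition2:
  fixes x :: nat
  assumes "x \<in> verts squarefree_graph"
  shows "(\<exists>m::int. m \<ge> -1 \<and> evako_sphere m (lower_sphere squarefree_graph real x)) \<and>
    1 - euler_char (lower_sphere squarefree_graph real x) = - moebius_mu x"
proof -
  define w where "w = card (prime_factors x)"
  have x: "squarefree x" "x \<ge> 2" using assms by auto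
  then have "w > 0" using x by (auto simp: w_def card_gt_0_iff prime_factorization_empty_iff)
  have sph: "evako_sphere (int w - 2) (lower_sphere squarefree_graph real x)"
    using open_interval_sphere[of x 1] x lower_sphere_squarefree_graph[OF assms]
    by (simp add: w_def)
  moreover have "1 - euler_char (lower_sphere squarefree_graph real x) = (-1) ^ (w - 1)"
    using euler_char_sphere[OF sph] \<open>w > 0\<close> by (simp add: nat_diff_distrib algebra_simps)
  moreover have "(-1) ^ (w - 1) = - moebius_mu x"
    using \<open>w > 0\<close> x by (cases w) (auto simp: moebius_mu_def w_def)
  ultimately show ?thesis
    using \<open>w > 0\<close> by (intro conjI exI[of _ "int w - 2"]) auto
qed

end
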